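(* Let $K$ be the finite field with $q$ elements, where $q\equiv 1 \pmod 4$. Let $\widetilde G=\mathrm{SL}(2,K)$ and let $\nu$ be a generator of the multiplicative group $K^\times$ of $K$. Let $$a=\begin{pmatrix}\nu & 0 \\ 0 & \nu^{-1}\end{pmatrix}, \qquad b=\begin{pmatrix} 0 & 1 \\ -1 & 0 \end{pmatrix},$$ and let $H$ be the subgroup of $\widetilde G$ generated by $a$ and $b$. Then for every $x\in \widetilde G\setminus H$ the coset $Hx$ contains an element of odd order.
   Context: Cosets are written as $Hx=\{hx\mid h\in H\}$. *)

theory Defs
  imports "HOL-Analysis.Analysis" "HOL-Algebra.Algebraic_Closure_Type"
    "HOL-Algebra.Multiplicative_Group" "HOL-Algebra.Coset" "HOL-Algebra.Generated_Groups"
begin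

definition SL2 :: "('a::field ^ 2 ^ 2) monoid" where
  "SL2 = \<lparr>carrier = {A. det A = 1}, monoid.mult = (**), one = mat 1\<rparr>"

definition mat22 :: "'a \<Rightarrow> 'a \<Rightarrow> 'a \<Rightarrow> 'a::zero \<Rightarrow> 'a ^ 2 ^ 2" where
  "mat22 p q r s = vector [vector [p, q], vector [r, s]]"

abbreviation mult_group :: "'a::field monoid" where
  "mult_group \<equiv> mult_of ring_of_type_algebra"

(* Membership in the carrier is required separately because the library's generate does not
   check that the generators lie in the group. *)
definition generates_mult_group :: "'a::field \<Rightarrow> bool" where
  "generates_mult_group \<nu> \<longleftrightarrow>
     \<nu> \<in> carrier mult_group \<and> generate mult_group {\<nu>} = carrier mult_group"

definition mat_a :: "'a::field \<Rightarrow> 'a ^ 2 ^ 2" where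
  "mat_a \<nu> = mat22 \<nu> 0 0 (inverse \<nu>)"

definition mat_b :: "'a::field ^ 2 ^ 2" where
  "mat_b = mat22 0 1 (-1) 0"

definition subgroup_H :: "'a::field \<Rightarrow> ('a ^ 2 ^ 2) set" where
  "subgroup_H \<nu> = generate SL2 {mat_a \<nu>, mat_b}"

lemma carrier_mult_group: "carrier (mult_group :: 'a::field monoid) = - {0}"
  by (auto simp: ring_of_type_algebra_def)

lemma mat22_nth [simp]:
  "mat22 p q r s $ 1 $ 1 = p" "mat22 p q r s $ 1 $ 2 = q"
  "mat22 p q r s $ 2 $ 1 = r" "mat22 p q r s $ 2 $ 2 = s"
  by (simp_all add: mat22_def)

lemma group_SL2: "group (SL2 :: ('a::field ^ 2 ^ 2) monoid)"
proof (rule groupI)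
  fix A :: "'a ^ 2 ^ 2"
  assume "A \<in> carrier SL2"
  then have d: "det A = 1" by (simp add: SL2_def)
  then have "invertible A" by (simp add: invertible_det_nz)
  then obtain B where B: "B ** A = mat 1" unfolding invertible_def by blast
  then have "det B * det A = 1" by (metis det_mul det_I)
  with d B show "\<exists>B\<in>carrier SL2. B \<otimes>\<^bsub>SL2\<^esub> A = \<one>\<^bsub>SL2\<^esub>"
    by (auto simp: SL2_def)
qed (auto simp: SL2_def det_mul matrix_mul_assoc)

lemma mat_a_in_SL2: "\<nu> \<noteq> 0 \<Longrightarrow> mat_a \<nu> \<in> carrier SL2"
  by (simp add: SL2_def mat_a_def det_2)

lemma mat_b_in_SL2: "mat_b \<in> carrier SL2"
  by (simp add: SL2_def mat_b_def det_2)

lemma subgroup_H_subgroup: "\<nu> \<noteq> 0 \<Longrightarrow> subgroup (subgroup_H \<nu>) SL2"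
  unfolding subgroup_H_def
  by (intro group.generate_is_subgroup group_SL2) (simp add: mat_a_in_SL2 mat_b_in_SL2)

end

theory Submission
  imports Defs "HOL-Number_Theory.Residues"
begin

text \<open>
  Write \<open>x = (\<alpha>, \<beta>; \<gamma>, \<delta>)\<close>. The coset \<open>Hx\<close> contains, for every \<open>t \<noteq> 0\<close>, the matrix
  \<open>diag(t, 1/t) x\<close> of trace \<open>t\<alpha> + \<delta>/t\<close>, so the task is to choose \<open>t\<close> such that this trace forces
  odd order. Two kinds of trace are used.

  \<^item> Trace \<open>2\<close>. Such a matrix is unipotent, and its \<open>q\<close>-th power is \<open>1\<close> with \<open>q\<close> odd
    (\<open>odd_ord_unipotent\<close>).
  \<^item> A trace \<open>\<tau>\<close> not of the form \<open>\<lambda> + 1/\<lambda>\<close> with \<open>\<lambda>\<close> in the field, that is, a matrix \<open>A\<close> without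
    eigenvalues in the field. As \<open>-1 = i\<^sup>2\<close> in the field, every \<open>B\<close> in \<open>SL\<^sub>2\<close> with \<open>B\<^sup>2 = -1\<close> is
    diagonalizable over the field with distinct eigenvalues, so it cannot commute with \<open>A\<close>. Hence
    the 2-part of the order of \<open>A\<close> is at most 2, and \<open>A\<close> or \<open>-A\<close> has odd order
    (\<open>odd_ord_up_to_sign\<close>). Both lie in \<open>Hx\<close>, as \<open>-1 \<in> H\<close>.

  The equation \<open>t\<alpha> + \<delta>/t = 2\<close> has discriminant \<open>4(1 - \<alpha>\<delta>) = -4\<beta>\<gamma>\<close>, so, \<open>-1\<close> being a square, it is
  solvable when \<open>\<beta>\<gamma>\<close> is a square; here \<open>x \<notin> H\<close> excludes \<open>\<alpha> = \<delta> = 0\<close>. Passing from \<open>x\<close> to \<open>bx\<close>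
  replaces \<open>\<beta>\<gamma>\<close> by \<open>-\<alpha>\<delta>\<close>, so it is enough that \<open>\<alpha>\<delta>\<close> or \<open>\<beta>\<gamma>\<close> is a square. If neither is, the values \<open>t\<alpha> + \<delta>/t\<close> avoid \<open>2\<close> and
  \<open>-2\<close>, and there are at least \<open>(q - 1)/2\<close> of them, because each is taken at most twice. On the other
  hand, at most \<open>(q - 3)/2\<close> elements other than \<open>2\<close> and \<open>-2\<close> have the form \<open>\<lambda> + 1/\<lambda>\<close>. So some
  trace is of the second kind (\<open>exists_trace_without_eigenvalue\<close>).
\<close>

(* fps_nth competes with the entry selector of vectors for the same infix symbol. *)
no_notation fps_nth (infixl "$" 75)

section \<open>Finite fields\<close>

lemma of_nat_card_UNIV: "of_nat CARD('a) = (0 :: 'a::{field, finite})"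
  using CHAR_dvd_CARD[where 'a = 'a] by (simp add: of_nat_eq_0_iff_char_dvd)

lemma mult_group_simps:
  "x \<otimes>\<^bsub>mult_group\<^esub> y = x * y" "\<one>\<^bsub>mult_group\<^esub> = 1"
  by (simp_all add: Ring_Divisibility.mult_of_def ring_of_type_algebra_def)

text \<open>
  Two library constants are called \<open>mult_of\<close>. The group \<open>mult_group\<close> is built on the one from
  \<open>Ring_Divisibility\<close>, whereas \<open>field_mult_group\<close> speaks of the one from \<open>Multiplicative_Group\<close>.
\<close>

lemma group_mult_group: "group (mult_group :: 'a::field monoid)"
proof (rule groupI)
  fix x :: 'a
  assume "x \<in> carrier mult_group"
  then show "\<exists>y \<in> carrier mult_group. y \<otimes>\<^bsub>mult_group\<^esub> x = \<one>\<^bsub>mult_group\<^esub>"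
    unfolding carrier_mult_group mult_group_simps by (intro bexI[of _ "inverse x"]) auto
qed (auto simp: ring_of_type_algebra_def mult.assoc)

lemma power_card_minus_1:
  fixes t :: "'a::{field, finite}"
  assumes "t \<noteq> 0"
  shows "t ^ (CARD('a) - 1) = 1"
proof -
  interpret M: group "mult_group :: 'a monoid"
    by (rule group_mult_group)
  have pow: "t [^]\<^bsub>mult_group\<^esub> n = t ^ n" for n :: nat
    by (induction n) (simp_all add: ring_of_type_algebra_def mult.commute)
  have "order (mult_group :: 'a monoid) = CARD('a) - 1"
    unfolding order_def carrier_mult_group by (simp add: Compl_eq_Diff_UNIV)
  moreover have "t [^]\<^bsub>mult_group\<^esub> order (mult_group :: 'a monoid) = \<one>\<^bsub>mult_group\<^esub>"
    using assms by (intro M.pow_order_eq_1) (simp only: carrier_mult_group, simp)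
  ultimately have "t ^ (CARD('a) - 1) = \<one>\<^bsub>mult_group\<^esub>"
    by (simp only: pow)
  then show ?thesis
    by (simp only: mult_group_simps)
qed

text \<open>
  Write \<open>q = 4k + 1\<close>. The polynomial \<open>X\<^sup>2\<^sup>k - 1\<close> has too few roots to vanish at all nonzero elements;
  at a nonzero \<open>t\<close> that is not a root, \<open>t\<^sup>2\<^sup>k\<close> is a square root of \<open>t\<^sup>4\<^sup>k = 1\<close> other than \<open>1\<close>, so
  \<open>t\<^sup>2\<^sup>k = -1\<close>.
\<close>

lemma minus_one_square:
  assumes "CARD('a::{field, finite}) mod 4 = 1"
  shows "\<exists>i :: 'a. i * i = - 1"
proof -
  define k where "k = CARD('a) div 4"
  have card: "CARD('a) = 4 * k + 1"
    using assms by (simp add: k_def) presburger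
  have "CARD('a) > 1"
    using card_mono[of "UNIV :: 'a set" "{0, 1}"] by simp
  then have k: "k > 0"
    using card by simp
  define p :: "'a poly" where "p = Polynomial.monom 1 (2 * k) - 1"
  have "Polynomial.coeff p (2 * k) = 1"
    using k by (simp add: p_def)
  then have "p \<noteq> 0" by auto
  moreover have "Polynomial.degree p \<le> 2 * k"
    by (simp add: p_def degree_diff_le degree_monom_le)
  ultimately have "card {t. poly p t = 0} \<le> 2 * k"
    using card_poly_roots_bound[of p] by linarith
  moreover have "card (- {0 :: 'a}) = 4 * k"
    by (simp add: card Compl_eq_Diff_UNIV)
  ultimately have "card {t. poly p t = 0} < card (- {0 :: 'a})"
    using k by linarith
  then have "\<not> - {0} \<subseteq> {t. poly p t = 0}"
    by (meson card_mono finite not_le)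
  then obtain t where "t \<noteq> 0" "poly p t \<noteq> 0"
    by blast
  then have t: "t \<noteq> 0" "t ^ (2 * k) \<noteq> 1"
    by (simp_all add: p_def poly_monom)
  have "(t ^ (2 * k)) ^ 2 = 1"
    using power_card_minus_1[OF t(1)] by (simp add: card flip: power_mult)
  then have "t ^ (2 * k) = - 1"
    using t(2) by (simp add: power2_eq_1_iff)
  then have "t ^ k * t ^ k = - 1"
    by (simp add: mult_2 power_add)
  then show ?thesis by blast
qed

section \<open>Two-by-two matrices of determinant one\<close>

lemma mat2_eq_iff:
  "A = B \<longleftrightarrow> A$1$1 = B$1$1 \<and> A$1$2 = B$1$2 \<and> A$2$1 = B$2$1 \<and> A$2$2 = (B :: 'a ^ 2 ^ 2)$2$2"
  by (auto simp: vec_eq_iff forall_2)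

lemma mat2_mult_nth:
  "(A ** B) $ i $ j = A$i$1 * B$1$j + A$i$2 * (B :: 'a::semiring_1 ^ 2 ^ 2)$2$j"
  by (simp add: matrix_matrix_mult_def sum_2)

lemma mat2_one_nth [simp]:
  "(mat 1 :: 'a::zero_neq_one ^ 2 ^ 2) $ 1 $ 1 = 1"
  "(mat 1 :: 'a::zero_neq_one ^ 2 ^ 2) $ 1 $ 2 = 0"
  "(mat 1 :: 'a::zero_neq_one ^ 2 ^ 2) $ 2 $ 1 = 0"
  "(mat 1 :: 'a::zero_neq_one ^ 2 ^ 2) $ 2 $ 2 = 1"
  by (simp_all add: mat_def)

lemma trace_mat2: "trace (A :: 'a::comm_semiring_1 ^ 2 ^ 2) = A$1$1 + A$2$2"
  by (simp add: trace_def sum_2)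

lemma SL2_simps [simp]:
  "A \<otimes>\<^bsub>SL2\<^esub> B = A ** B" "\<one>\<^bsub>SL2\<^esub> = mat 1"
  by (simp_all add: SL2_def)

lemma in_SL2_iff: "A \<in> carrier SL2 \<longleftrightarrow> A$1$1 * A$2$2 - A$1$2 * A$2$1 = 1"
  by (simp add: SL2_def det_2)

interpretation SL2: group SL2
  by (rule group_SL2)

lemma uminus_in_SL2: "A \<in> carrier SL2 \<Longrightarrow> - A \<in> carrier SL2"
  by (simp add: in_SL2_iff)

lemma uminus_pow_odd:
  fixes A :: "'a::field ^ 2 ^ 2" and n :: nat
  assumes "odd n"
  shows "(- A) [^]\<^bsub>SL2\<^esub> n = - (A [^]\<^bsub>SL2\<^esub> n)"
proof -
  have "(- A) [^]\<^bsub>SL2\<^esub> n = (if even n then A [^]\<^bsub>SL2\<^esub> n else - (A [^]\<^bsub>SL2\<^esub> n))" for n :: nat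
    by (induction n) (auto simp: mat2_eq_iff mat2_mult_nth)
  with assms show ?thesis by simp
qed

text \<open>
  With \<open>A = 1 + N\<close>, the Cayley-Hamilton theorem gives \<open>N\<^sup>2 = 0\<close>, hence \<open>A\<^sup>n = 1 + n N\<close>.
\<close>

lemma unipotent_pow_nth:
  fixes A :: "'a::field ^ 2 ^ 2"
  assumes "A \<in> carrier SL2" "trace A = 2"
  shows "(A [^]\<^bsub>SL2\<^esub> n) $ i $ j = mat 1 $ i $ j + of_nat n * (A $ i $ j - mat 1 $ i $ j)"
proof -
  have det: "A$1$1 * A$2$2 - A$1$2 * A$2$1 = 1" and tr: "A$2$2 = 2 - A$1$1"
    using assms by (simp_all add: in_SL2_iff trace_mat2 algebra_simps)
  have bc: "A$1$2 * A$2$1 = - ((A$1$1 - 1) * (A$1$1 - 1))"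
    using det unfolding tr by (simp add: algebra_simps)
  have "A [^]\<^bsub>SL2\<^esub> n = mat22 (1 + of_nat n * (A$1$1 - 1)) (of_nat n * A$1$2)
      (of_nat n * A$2$1) (1 + of_nat n * (A$2$2 - 1))"
  proof (induction n)
    case 0
    then show ?case by (simp add: mat2_eq_iff)
  next
    case (Suc n)
    have bc': "1 + (A$1$1 * A$1$1 + A$1$2 * A$2$1) = 2 * A$1$1"
      using bc by (simp add: algebra_simps)
    have "of_nat n + (of_nat n * (A$1$1 * A$1$1) + of_nat n * (A$1$2 * A$2$1))
        = of_nat n * (1 + (A$1$1 * A$1$1 + A$1$2 * A$2$1))"
      by (simp add: distrib_left)
    also have "\<dots> = of_nat n * (2 * A$1$1)"
      by (simp only: bc')
    finally show ?case
      using bc' unfolding SL2.nat_pow_Suc Suc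
      by (simp add: mat2_eq_iff mat2_mult_nth tr) (auto simp: algebra_simps)
  qed
  then show ?thesis
    using exhaust_2[of i] exhaust_2[of j] by auto
qed

lemma odd_ord_unipotent:
  fixes A :: "'a::{field, finite} ^ 2 ^ 2"
  assumes "odd CARD('a)" "A \<in> carrier SL2" "trace A = 2"
  shows "odd (SL2.ord A)"
proof -
  have "A [^]\<^bsub>SL2\<^esub> CARD('a) = \<one>\<^bsub>SL2\<^esub>"
    using assms(2,3) by (simp add: vec_eq_iff unipotent_pow_nth of_nat_card_UNIV)
  then have "SL2.ord A dvd CARD('a)"
    using SL2.pow_eq_id[OF assms(2), of "CARD('a)"] by simp
  with assms(1) show ?thesis
    by (meson dvd_trans)
qed

text \<open>
  By Cayley-Hamilton, \<open>B\<^sup>2 = 1\<close> gives \<open>(tr B) B = 2\<close>, so \<open>B\<close> is scalar when \<open>2 \<noteq> 0\<close>.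
\<close>

lemma square_eq_one:
  fixes B :: "'a::field ^ 2 ^ 2"
  assumes "(2 :: 'a) \<noteq> 0" "B \<in> carrier SL2" "B ** B = mat 1"
  shows "B = mat 1 \<or> B = - mat 1"
proof -
  define a b c d where abcd: "a = B$1$1" "b = B$1$2" "c = B$2$1" "d = B$2$2"
  have eqs: "a * a + b * c = 1" "a * b + b * d = 0" "c * a + d * c = 0" "a * d - b * c = 1"
    using assms(2,3) by (simp_all add: mat2_eq_iff mat2_mult_nth in_SL2_iff abcd)
  have "a * (a + d) = 2"
    using eqs(1,4) by (simp add: algebra_simps)
  with assms(1) have nz: "a + d \<noteq> 0" by auto
  moreover have "b * (a + d) = 0" "c * (a + d) = 0"
    using eqs(2,3) by (simp_all add: algebra_simps)
  ultimately have bc: "b = 0" "c = 0" by simp_all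
  then have "a = 1 \<or> a = - 1" "a * d = 1"
    using eqs by (simp_all add: square_eq_1_iff)
  then have "a = 1 \<and> d = 1 \<or> a = - 1 \<and> d = - 1"
    by (auto simp: minus_equation_iff[of d])
  then show ?thesis
    using bc by (auto simp: mat2_eq_iff abcd)
qed

text \<open>
  A square root \<open>B\<close> of \<open>-1\<close> in \<open>SL\<^sub>2\<close> has trace \<open>0\<close>, so its eigenvalues \<open>i\<close> and \<open>-i\<close> are distinct
  and lie in the field. A matrix commuting with \<open>B\<close> preserves the eigenlines of \<open>B\<close>; explicitly,
  it is \<open>h + u B\<close> with \<open>h\<close> and \<open>u\<close> in the field, so it has the eigenvalue \<open>h + u i\<close>.
\<close>

lemma eigenvalue_if_commutes_with_root_of_minus_one:
  fixes A B :: "'a::field ^ 2 ^ 2"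
  assumes "(2 :: 'a) \<noteq> 0" "i * i = (- 1 :: 'a)" "A \<in> carrier SL2" "B \<in> carrier SL2"
    and "B ** B = - mat 1" "A ** B = B ** A"
  shows "\<exists>l. l * l - trace A * l + 1 = 0"
proof -
  define a b c d where abcd: "a = B$1$1" "b = B$1$2" "c = B$2$1" "d = B$2$2"
  define p q r s where pqrs: "p = A$1$1" "q = A$1$2" "r = A$2$1" "s = A$2$2"
  have eqs: "a * a + b * c = - 1" "a * b + b * d = 0" "c * a + d * c = 0" "c * b + d * d = - 1"
      "a * d - b * c = 1"
    using assms(4,5) by (simp_all add: mat2_eq_iff mat2_mult_nth in_SL2_iff abcd)
  have det: "p * s - q * r = 1"
    using assms(3) by (simp add: in_SL2_iff pqrs)
  have "p * a + q * c = a * p + b * r"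
    and com2: "p * b + q * d = a * q + b * s" and com3: "r * a + s * c = c * p + d * r"
    using assms(6) by (simp_all add: mat2_eq_iff mat2_mult_nth flip: abcd pqrs)
  then have com1: "q * c = b * r"
    by (simp add: mult.commute)
  have "(a + d) * a = 0" "(a + d) * b = 0" "(a + d) * c = 0"
    using eqs by (simp_all add: algebra_simps)
  moreover have "a \<noteq> 0 \<or> b \<noteq> 0"
    using eqs(1) by auto
  ultimately have d: "d = - a"
    by (auto simp: eq_neg_iff_add_eq_0 add.commute)
  (* u is the coefficient of B; the equation A = h + u B determines it from the entry b, or, if
     b = 0, from the difference of the diagonal entries. *)
  obtain u where u: "p - s = 2 * (u * a)" "q = u * b" "r = u * c"
  proof (cases "b = 0")
    case True
    then have "a \<noteq> 0" using eqs(1) by auto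
    show ?thesis
    proof (rule that[of "(p - s) / (2 * a)"])
      show "p - s = 2 * ((p - s) / (2 * a) * a)"
        using \<open>a \<noteq> 0\<close> assms(1) by (simp add: field_simps)
      have "2 * a * q = 0"
        using com2 True d by (simp add: algebra_simps)
      then show "q = (p - s) / (2 * a) * b"
        using True \<open>a \<noteq> 0\<close> assms(1) by simp
      have "2 * a * r = (p - s) * c"
        using com3 d by (simp add: algebra_simps)
      then show "r = (p - s) / (2 * a) * c"
        using \<open>a \<noteq> 0\<close> assms(1) by (simp add: field_simps)
    qed
  next
    case False
    show ?thesis
    proof (rule that[of "q / b"])
      have "(p - s) * b = 2 * q * a"
        using com2 d by (simp add: algebra_simps)
      then show "p - s = 2 * (q / b * a)"
        using False by (simp add: field_simps)
    qed (use False com1 in \<open>simp_all add: field_simps\<close>)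
  qed
  (* h is half the trace of A, written without a division. *)
  define h where "h = s + u * a"
  have ps: "s = h - u * a" "p = h + u * a"
    using u(1) by (simp_all add: h_def algebra_simps)
  have "h * h - u * u * (a * a + b * c) = 1"
    using det unfolding ps u(2,3) by (simp add: algebra_simps)
  then have hu: "h * h + u * u = 1"
    unfolding eqs(1) by simp
  define l where "l = h + u * i"
  have "l * l - (p + s) * l + 1 = (l - h) * (l - h) - h * h + 1"
    unfolding ps by (simp add: algebra_simps)
  also have "(l - h) * (l - h) = (u * u) * (i * i)"
    by (simp add: l_def mult_ac)
  also have "(u * u) * (i * i) - h * h + 1 = 1 - (h * h + u * u)"
    unfolding assms(2) by (simp add: algebra_simps)
  also have "\<dots> = 0"
    unfolding hu by simp
  finally show ?thesis
    unfolding trace_mat2 pqrs by blast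
qed

text \<open>
  Hence in the centralizer of a matrix without eigenvalues in the field, \<open>-1\<close> is the only element of
  order 2 and is not a square, so there is no element of order 4.
\<close>

lemma two_power_torsion_in_centralizer:
  fixes A B :: "'a::field ^ 2 ^ 2"
  assumes "(2 :: 'a) \<noteq> 0" "i * i = (- 1 :: 'a)" "A \<in> carrier SL2"
    and noev: "\<And>l. l * l - trace A * l + 1 \<noteq> 0"
    and "B \<in> carrier SL2" "A ** B = B ** A" "B [^]\<^bsub>SL2\<^esub> ((2 :: nat) ^ k) = mat 1"
  shows "B = mat 1 \<or> B = - mat 1"
  using assms(5-7)
proof (induction k arbitrary: B)
  case 0
  then show ?case using SL2.nat_pow_eone by simp
next
  case (Suc k)
  have sq: "B [^]\<^bsub>SL2\<^esub> (2 :: nat) = B ** B"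
    using Suc.prems(1) by (simp add: numeral_2_eq_2)
  have closed: "B ** B \<in> carrier SL2"
    using SL2.m_closed[OF Suc.prems(1,1)] by simp
  have "(B ** B) [^]\<^bsub>SL2\<^esub> ((2 :: nat) ^ k) = mat 1"
    using SL2.nat_pow_pow[OF Suc.prems(1), of 2 "2 ^ k"] Suc.prems(3) sq by simp
  moreover have "A ** (B ** B) = (B ** B) ** A"
    using Suc.prems(2) by (metis matrix_mul_assoc)
  ultimately have "B ** B = mat 1 \<or> B ** B = - mat 1"
    using closed by (intro Suc.IH)
  then show ?case
  proof
    assume "B ** B = mat 1"
    then show ?thesis
      using square_eq_one assms(1) Suc.prems(1) by blast
  next
    assume "B ** B = - mat 1"
    then show ?thesis
      using eigenvalue_if_commutes_with_root_of_minus_one[OF assms(1-3) Suc.prems(1) _ Suc.prems(2)]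
        noev by blast
  qed
qed

text \<open>
  If the order of \<open>A\<close> is \<open>2\<^sup>k m\<close> with \<open>m\<close> odd, then \<open>A\<^sup>m\<close> is 2-power torsion in the centralizer of \<open>A\<close>,
  so it is \<open>1\<close> or \<open>-1\<close>; in the second case \<open>(-A)\<^sup>m = 1\<close>.
\<close>

lemma odd_ord_up_to_sign:
  fixes A :: "'a::{field, finite} ^ 2 ^ 2"
  assumes "(2 :: 'a) \<noteq> 0" "i * i = (- 1 :: 'a)" "A \<in> carrier SL2"
    and noev: "\<And>l. l * l - trace A * l + 1 \<noteq> 0"
  shows "odd (SL2.ord A) \<or> odd (SL2.ord (- A))"
proof -
  have "SL2.ord A \<noteq> 0"
    using SL2.ord_ge_1[OF _ assms(3)] by simp
  then obtain m where "SL2.ord A = 2 ^ multiplicity 2 (SL2.ord A) * m" and m: "odd m"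
    by (rule multiplicity_decompose'[of "SL2.ord A" "2 :: nat"]) auto
  then obtain k where n: "SL2.ord A = 2 ^ k * m" by blast
  let ?B = "A [^]\<^bsub>SL2\<^esub> m"
  have "?B [^]\<^bsub>SL2\<^esub> ((2 :: nat) ^ k) = mat 1"
    using assms(3) SL2.pow_ord_eq_1[OF assms(3)] n by (simp add: SL2.nat_pow_pow mult.commute)
  moreover have "A ** ?B = ?B ** A"
    using SL2.nat_pow_Suc2[OF assms(3), of m] by simp
  moreover have "?B \<in> carrier SL2"
    using assms(3) by simp
  ultimately have "?B = mat 1 \<or> ?B = - mat 1"
    by (intro two_power_torsion_in_centralizer[OF assms]) auto
  then show ?thesis
  proof
    assume "?B = mat 1"
    then have "SL2.ord A dvd m"
      using assms(3) by (simp add: SL2.pow_eq_id[symmetric])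
    with m show ?thesis by (meson dvd_trans)
  next
    assume "?B = - mat 1"
    then have "(- A) [^]\<^bsub>SL2\<^esub> m = mat 1"
      by (simp add: uminus_pow_odd[OF m])
    then have "SL2.ord (- A) dvd m"
      using uminus_in_SL2[OF assms(3)] by (simp add: SL2.pow_eq_id[symmetric])
    with m show ?thesis by (meson dvd_trans)
  qed
qed

section \<open>Traces\<close>

lemma card_eq_sum_fibres:
  assumes "finite S"
  shows "card S = (\<Sum>y \<in> f ` S. card {x \<in> S. f x = y})"
  using sum_fun_comp[OF assms finite_imageI[OF assms], of f f "\<lambda>_. 1 :: nat"] by simp

lemma card_quadratic_roots_le:
  fixes a b c :: "'a::field"
  assumes "a \<noteq> 0"
  shows "card {t. a * t * t + b * t + c = 0} \<le> 2"
proof -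
  have "{t. a * t * t + b * t + c = 0} = {t. poly [:c, b, a:] t = 0}"
    by (simp add: algebra_simps)
  then show ?thesis
    using card_poly_roots_bound[of "[:c, b, a:]"] assms by simp
qed

text \<open>
  A pigeonhole argument. If every value of \<open>f t = t a + d/t\<close> were of the form \<open>g l = l + 1/l\<close>, then, as
  \<open>2 = g 1\<close> and \<open>-2 = g (-1)\<close> are not among them, \<open>f\<close> would map the nonzero elements into the
  image under \<open>g\<close> of the strictly smaller set of elements other than \<open>0\<close>, \<open>1\<close> and \<open>-1\<close>. But \<open>f\<close> is at most
  two-to-one, being given by a quadratic equation, and \<open>g\<close> is at least two-to-one on those elements,
  since it identifies \<open>l\<close> with \<open>1/l \<noteq> l\<close>.
\<close>

lemma exists_trace_without_eigenvalue:
  fixes a d :: "'a::{field, finite}"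
  assumes "a \<noteq> 0"
    and ne2: "\<And>t. t \<noteq> 0 \<Longrightarrow> t * a + d / t \<noteq> 2 \<and> t * a + d / t \<noteq> - 2"
  shows "\<exists>t. t \<noteq> 0 \<and> (\<forall>l. l * l - (t * a + d / t) * l + 1 \<noteq> 0)"
proof (rule ccontr)
  assume "\<not> ?thesis"
  then have ev: "\<exists>l. l * l - (t * a + d / t) * l + 1 = 0" if "t \<noteq> 0" for t
    using that by blast
  define f where "f t = t * a + d / t" for t
  define g :: "'a \<Rightarrow> 'a" where "g l = l + inverse l" for l
  have "f ` (- {0}) \<subseteq> g ` (- {0, 1, - 1})"
  proof
    fix y assume "y \<in> f ` (- {0})"
    then obtain t where t: "t \<noteq> 0" "y = f t" by auto
    then obtain l where l: "l * l - y * l + 1 = 0"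
      using ev[OF t(1)] by (auto simp: f_def)
    then have "l \<noteq> 0" by auto
    then have y: "y = g l"
      using l by (simp add: g_def field_simps)
    then have "l \<noteq> 1" "l \<noteq> - 1"
      using ne2[OF t(1)] t(2) by (auto simp: g_def f_def)
    with y \<open>l \<noteq> 0\<close> show "y \<in> g ` (- {0, 1, - 1})" by auto
  qed
  then have T_le_E: "card (f ` (- {0})) \<le> card (g ` (- {0, 1, - 1}))"
    by (intro card_mono) auto
  have "card (- {0 :: 'a}) \<le> (\<Sum>y \<in> f ` (- {0}). 2)"
    unfolding card_eq_sum_fibres[of "- {0}" f, OF finite]
  proof (rule sum_mono)
    fix y
    have "{t \<in> - {0}. f t = y} \<subseteq> {t. a * t * t + (- y) * t + d = 0}"
      by (auto simp: f_def field_simps)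
    then show "card {t \<in> - {0}. f t = y} \<le> 2"
      using card_quadratic_roots_le[OF assms(1), of "- y" d] by (meson card_mono finite le_trans)
  qed
  moreover have "(\<Sum>y \<in> g ` (- {0, 1, - 1}). 2) \<le> card (- {0 :: 'a, 1, - 1})"
    unfolding card_eq_sum_fibres[of "- {0, 1, - 1}" g, OF finite]
  proof (rule sum_mono)
    fix y assume "y \<in> g ` (- {0, 1, - 1})"
    then obtain l where l: "l \<noteq> 0" "l \<noteq> 1" "l \<noteq> - 1" "y = g l" by auto
    have "inverse l \<noteq> l"
    proof
      assume "inverse l = l"
      then have "l * l = 1" using l(1) by (metis right_inverse)
      with l show False by (simp add: square_eq_1_iff)
    qed
    then have "card {l, inverse l} = 2" by simp
    moreover have "{l, inverse l} \<subseteq> {l \<in> - {0, 1, - 1}. g l = y}"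
      using l by (auto simp: g_def inverse_eq_iff_eq[of l "- 1", simplified])
    ultimately show "2 \<le> card {l \<in> - {0, 1, - 1}. g l = y}"
      by (metis card_mono finite)
  qed
  moreover have "card (- {0 :: 'a, 1, - 1}) < card (- {0 :: 'a})"
    by (rule psubset_card_mono) auto
  ultimately show False
    using T_le_E by simp
qed

text \<open>
  For \<open>a \<noteq> 0\<close>, the equation for \<open>w = t a\<close> is \<open>(w - 1)\<^sup>2 = 1 - a d = -s\<^sup>2\<close>, with the roots
  \<open>1 + i s\<close> and \<open>1 - i s\<close>. Their sum is \<open>2\<close>, so at least one of them is nonzero.
\<close>

lemma exists_trace_two:
  fixes a d s :: "'a::field"
  assumes "(2 :: 'a) \<noteq> 0" "i * i = (- 1 :: 'a)"
    and "a \<noteq> 0 \<or> d \<noteq> 0" "a * d - s * s = 1"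
  shows "\<exists>t. t \<noteq> 0 \<and> t * a + d / t = 2"
proof (cases "a = 0")
  case True
  with assms show ?thesis
    by (intro exI[of _ "d / 2"]) simp
next
  case a: False
  have root: "w / a * a + d / (w / a) = 2" if "w \<noteq> 0" "w = 1 + i * s \<or> w = 1 - i * s" for w
  proof -
    have "w * w + a * d = 2 * w + (w - 1) * (w - 1) + (a * d - 1)"
      by (simp add: algebra_simps)
    also have "(w - 1) * (w - 1) = (i * i) * (s * s)"
      using that(2) by (auto simp: mult_ac)
    also have "a * d - 1 = s * s"
      using assms(4) by (simp add: diff_eq_eq add.commute)
    finally have "w * w + a * d = 2 * w"
      using assms(2) by simp
    then show ?thesis using a that(1) by (simp add: field_simps)
  qed
  have "1 + i * s \<noteq> 0 \<or> 1 - i * s \<noteq> 0"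
  proof (rule ccontr)
    assume "\<not> ?thesis"
    then have "1 + i * s = 0" "1 - i * s = 0" by blast+
    then have "(1 + i * s) + (1 - i * s) = 0" by (simp only: add_0)
    with assms(1) show False by simp
  qed
  then obtain w where "w \<noteq> 0" "w = 1 + i * s \<or> w = 1 - i * s" by blast
  then show ?thesis
    using root[of w] a by (intro exI[of _ "w / a"]) auto
qed

section \<open>The cosets of H\<close>

text \<open>
  The map \<open>t \<mapsto> diag(t, 1/t)\<close> is a homomorphism from the multiplicative group that sends the generator
  \<open>\<nu>\<close> to \<open>a\<close>.
\<close>

lemma diagonal_in_H:
  fixes \<nu> t :: "'a::field"
  assumes "generates_mult_group \<nu>" "t \<noteq> 0"
  shows "mat22 t 0 0 (inverse t) \<in> subgroup_H \<nu>"
proof -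
  interpret M: group "mult_group :: 'a monoid"
    by (rule group_mult_group)
  have nz: "\<nu> \<noteq> 0"
    using assms(1) unfolding generates_mult_group_def carrier_mult_group by simp
  interpret H: subgroup "subgroup_H \<nu>" SL2
    by (rule subgroup_H_subgroup[OF nz])
  have a: "mat22 \<nu> 0 0 (inverse \<nu>) \<in> subgroup_H \<nu>"
    unfolding subgroup_H_def mat_a_def[symmetric] by (rule generate.incl) simp
  have "t \<in> generate mult_group {\<nu>}"
    using assms unfolding generates_mult_group_def carrier_mult_group by simp
  then show ?thesis
  proof induction
    case one
    have "mat22 1 0 0 (inverse 1) = (\<one>\<^bsub>SL2\<^esub> :: 'a ^ 2 ^ 2)"
      by (simp add: mat2_eq_iff)
    then show ?case
      using H.one_closed by (simp add: ring_of_type_algebra_def)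
  next
    case (incl h)
    with a show ?case by simp
  next
    case (inv h)
    have "inv\<^bsub>mult_group\<^esub> \<nu> = inverse \<nu>"
      using nz by (intro M.inv_equality) (simp_all add: ring_of_type_algebra_def)
    moreover have "inv\<^bsub>SL2\<^esub> mat22 \<nu> 0 0 (inverse \<nu>) = mat22 (inverse \<nu>) 0 0 \<nu>"
      using nz by (intro SL2.inv_equality)
        (simp_all add: in_SL2_iff mat2_eq_iff mat2_mult_nth)
    ultimately show ?case
      using H.m_inv_closed[OF a] inv by simp
  next
    case (eng h1 h2)
    have "mat22 h1 0 0 (inverse h1) \<otimes>\<^bsub>SL2\<^esub> mat22 h2 0 0 (inverse h2)
        = mat22 (h1 * h2) 0 0 (inverse (h1 * h2))"
      by (simp add: mat2_eq_iff mat2_mult_nth)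
    then show ?case
      using H.m_closed[OF eng.IH] by (simp add: ring_of_type_algebra_def)
  qed
qed

lemma mat_b_in_H: "mat_b \<in> subgroup_H \<nu>"
  unfolding subgroup_H_def by (rule generate.incl) simp

lemma odd_ord_in_coset_if_offdiagonal_square:
  fixes x :: "'a::{field, finite} ^ 2 ^ 2"
  assumes "odd CARD('a)" "(2 :: 'a) \<noteq> 0" "i * i = (- 1 :: 'a)"
    and "generates_mult_group \<nu>" "x \<in> carrier SL2"
    and "x$1$1 \<noteq> 0 \<or> x$2$2 \<noteq> 0" "x$1$2 * x$2$1 = s * s"
  shows "\<exists>h \<in> subgroup_H \<nu>. odd (SL2.ord (h ** x))"
proof -
  obtain t where t: "t \<noteq> 0" "t * x$1$1 + x$2$2 / t = 2"
    using exists_trace_two[OF assms(2,3,6), of s] assms(5,7) by (auto simp: in_SL2_iff)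
  let ?h = "mat22 t 0 0 (inverse t)"
  have "?h ** x \<in> carrier SL2"
    using SL2.m_closed[OF _ assms(5), of ?h] t(1) by (simp add: in_SL2_iff)
  moreover have "trace (?h ** x) = 2"
    using t by (simp add: trace_mat2 mat2_mult_nth field_simps)
  ultimately show ?thesis
    using odd_ord_unipotent[OF assms(1)] diagonal_in_H[OF assms(4) t(1)] by blast
qed

theorem proposition2p3:
  fixes \<nu> :: "'a::{field, finite}" and q :: nat and x :: "'a ^ 2 ^ 2"
  assumes "CARD('a) = q" and "q mod 4 = 1"
    and "generates_mult_group \<nu>"
    and "x \<in> carrier SL2 - subgroup_H \<nu>"
  shows "\<exists>y \<in> subgroup_H \<nu> #>\<^bsub>SL2\<^esub> x. odd (group.ord SL2 y)"
proof -
  have q: "CARD('a) mod 4 = 1" and odd: "odd CARD('a)"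
    using assms(1,2) by (auto, presburger)
  obtain i :: 'a where i: "i * i = - 1"
    using minus_one_square[OF q] by blast
  have two: "(2 :: 'a) \<noteq> 0"
  proof
    assume "(2 :: 'a) = 0"
    moreover have "of_nat CARD('a) = (2 * of_nat (CARD('a) div 2) + 1 :: 'a)"
      using odd by (metis odd_two_times_div_two_succ of_nat_1 of_nat_add of_nat_mult of_nat_numeral)
    ultimately show False
      by (simp add: of_nat_card_UNIV)
  qed
  have "(4 :: 'a) = 2 * 2" by simp
  then have four: "(4 :: 'a) \<noteq> 0"
    using two by (metis mult_eq_0_iff)
  have nz: "\<nu> \<noteq> 0"
    using assms(3) unfolding generates_mult_group_def carrier_mult_group by simp
  interpret H: subgroup "subgroup_H \<nu>" SL2
    by (rule subgroup_H_subgroup[OF nz])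
  have x: "x \<in> carrier SL2" "x \<notin> subgroup_H \<nu>"
    using assms(4) by auto
  have det: "x$1$1 * x$2$2 - x$1$2 * x$2$1 = 1"
    using x(1) by (simp add: in_SL2_iff)
  have mult: "h1 ** h2 \<in> subgroup_H \<nu>" if "h1 \<in> subgroup_H \<nu>" "h2 \<in> subgroup_H \<nu>" for h1 h2
    using H.m_closed[OF that] by simp
  (* A matrix with zero diagonal, or one with zero antidiagonal, lies in H. *)
  have diag: "x$1$1 \<noteq> 0 \<or> x$2$2 \<noteq> 0"
  proof (rule ccontr)
    assume *: "\<not> ?thesis"
    have "x$1$2 * x$2$1 = x$1$1 * x$2$2 - 1"
      using det by (simp add: algebra_simps)
    with * have "x$1$2 * x$2$1 = - 1" by simp
    then have "x$1$2 \<noteq> 0" "x$1$2 * - (x$2$1) = 1"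
      by auto
    then have "x$2$1 = - inverse (x$1$2)"
      by (metis inverse_unique minus_minus)
    with * have "x = mat22 (x$1$2) 0 0 (inverse (x$1$2)) ** mat_b"
      by (simp add: mat2_eq_iff mat2_mult_nth mat_b_def)
    with x(2) mult[OF diagonal_in_H[OF assms(3)] mat_b_in_H] \<open>x$1$2 \<noteq> 0\<close> show False by metis
  qed
  have offdiag: "x$2$1 \<noteq> 0 \<or> x$1$2 \<noteq> 0"
  proof (rule ccontr)
    assume *: "\<not> ?thesis"
    with det have prod: "x$1$1 * x$2$2 = 1" by simp
    then have "x$1$1 \<noteq> 0" by auto
    have "x$2$2 = inverse (x$1$1)"
      using inverse_unique[OF prod] by simp
    with * have "x = mat22 (x$1$1) 0 0 (inverse (x$1$1))"
      by (simp add: mat2_eq_iff)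
    with x(2) diagonal_in_H[OF assms(3)] \<open>x$1$1 \<noteq> 0\<close> show False by metis
  qed
  have "\<exists>h \<in> subgroup_H \<nu>. odd (SL2.ord (h ** x))"
  proof (cases "\<exists>s. x$1$2 * x$2$1 = s * s")
    case True
    then show ?thesis
      using odd_ord_in_coset_if_offdiagonal_square[OF odd two i assms(3) x(1) diag] by blast
  next
    case bc: False
    show ?thesis
    proof (cases "\<exists>s. x$1$1 * x$2$2 = s * s")
      case True
      then obtain s where s: "x$1$1 * x$2$2 = s * s" by blast
      (* The product of the antidiagonal entries of b x is -(x11 x22). *)
      have "mat_b ** x \<in> carrier SL2"
        using SL2.m_closed[OF mat_b_in_SL2 x(1)] by simp
      moreover have "(mat_b ** x)$1$1 \<noteq> 0 \<or> (mat_b ** x)$2$2 \<noteq> 0"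
        using offdiag by (simp add: mat2_mult_nth mat_b_def)
      moreover have "(mat_b ** x)$1$2 * (mat_b ** x)$2$1 = (i * s) * (i * s)"
      proof -
        have "(i * s) * (i * s) = (i * i) * (s * s)" by (simp add: mult_ac)
        then show ?thesis
          using s i by (simp add: mat2_mult_nth mat_b_def mult.commute)
      qed
      ultimately obtain h where "h \<in> subgroup_H \<nu>" "odd (SL2.ord (h ** (mat_b ** x)))"
        using odd_ord_in_coset_if_offdiagonal_square[OF odd two i assms(3)] by blast
      then show ?thesis
        using mult[OF _ mat_b_in_H] by (metis matrix_mul_assoc)
    next
      case ad: False
      then have a: "x$1$1 \<noteq> 0" by auto
      (* A trace c with c^2 = 4 would make x12 x21 a square: it equals (i e / 2)^2, where e is the
         difference of the diagonal entries of the matrix of trace c. *)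
      have ne: "t * x$1$1 + x$2$2 / t \<noteq> c" if "t \<noteq> 0" "c * c = 4" for t c
      proof
        assume c: "t * x$1$1 + x$2$2 / t = c"
        let ?e = "t * x$1$1 - x$2$2 / t"
        have "?e * ?e = c * c - 4 * (x$1$1 * x$2$2)"
          using that(1) unfolding c[symmetric] by (simp add: field_simps)
        also have "\<dots> = - (4 * (x$1$2 * x$2$1))"
          using det that(2) by (simp add: algebra_simps)
        finally have e: "?e * ?e = - (4 * (x$1$2 * x$2$1))" .
        have "(i * ?e / 2) * (i * ?e / 2) = (i * i) * (?e * ?e) / (2 * 2)"
          by (simp add: field_simps)
        also have "\<dots> = (4 * (x$1$2 * x$2$1)) / (2 * 2)"
          unfolding e i by simp
        also have "\<dots> = x$1$2 * x$2$1"
          using four by simp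
        finally show False using bc by metis
      qed
      obtain t where t: "t \<noteq> 0"
        and noev: "\<And>l. l * l - (t * x$1$1 + x$2$2 / t) * l + 1 \<noteq> 0"
        using exists_trace_without_eigenvalue[OF a, of "x$2$2"] ne by auto
      let ?h = "mat22 t 0 0 (inverse t)"
      have "?h ** x \<in> carrier SL2"
        using SL2.m_closed[OF _ x(1), of ?h] t by (simp add: in_SL2_iff)
      moreover have "trace (?h ** x) = t * x$1$1 + x$2$2 / t"
        by (simp add: trace_mat2 mat2_mult_nth field_simps)
      ultimately have "odd (SL2.ord (?h ** x)) \<or> odd (SL2.ord (- (?h ** x)))"
        using odd_ord_up_to_sign[OF two i] noev by auto
      moreover have "- (?h ** x) = mat22 (- t) 0 0 (inverse (- t)) ** x"
        by (simp add: mat2_eq_iff mat2_mult_nth)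
      ultimately show ?thesis
        using diagonal_in_H[OF assms(3)] t by (metis neg_equal_0_iff_equal)
    qed
  qed
  then show ?thesis
    by (auto simp: r_coset_def)
qed

end
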